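(* Let $R$ be a zero dimensional commutative ring. Then the idempotents of $R$ can be lifted modulo each ideal of $R$. If moreover $R$ is reduced, then the idempotents of $R$ can be lifted along each localization, i.e., for every multiplicative subset $S$ of $R$ the canonical ring map $R\rightarrow S^{-1}R$ lifts idempotents.
   Context: All rings are commutative with $1$. A ring is zero dimensional if its Krull dimension is $0$ (every prime ideal is maximal). A morphism of rings $\phi:R\rightarrow R'$ lifts idempotents if for every idempotent $e'\in R'$ there exists an idempotent $e\in R$ with $\phi(e)=e'$. The idempotents of $R$ can be lifted modulo an ideal $I$ if the canonical map $R\rightarrow R/I$ lifts idempotents. *)

theory Defs
  imports "HOL-Algebra.QuotRing"
begin

section \<open>Zero-dimensional and reduced rings\<close>

text \<open>The zero ring has no prime ideals and satisfies this condition vacuously.\<close>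

definition zero_dimensional :: "('a, 'm) ring_scheme \<Rightarrow> bool" where
  "zero_dimensional R \<longleftrightarrow> (\<forall>P. primeideal P R \<longrightarrow> maximalideal P R)"

definition reduced_ring :: "('a, 'm) ring_scheme \<Rightarrow> bool" where
  "reduced_ring R \<longleftrightarrow>
     (\<forall>x\<in>carrier R. \<forall>n::nat. x [^]\<^bsub>R\<^esub> n = \<zero>\<^bsub>R\<^esub> \<longrightarrow> x = \<zero>\<^bsub>R\<^esub>)"


section \<open>Lifting idempotents\<close>

definition ring_idempotents :: "('a, 'm) ring_scheme \<Rightarrow> 'a set" where
  "ring_idempotents R = {e \<in> carrier R. e \<otimes>\<^bsub>R\<^esub> e = e}"

definition lifts_idempotents ::
  "('a, 'm) ring_scheme \<Rightarrow> ('b, 'n) ring_scheme \<Rightarrow> ('a \<Rightarrow> 'b) \<Rightarrow> bool" where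
  "lifts_idempotents R R' \<phi> \<longleftrightarrow>
     (\<forall>e'\<in>ring_idempotents R'. \<exists>e\<in>ring_idempotents R. \<phi> e = e')"

definition idempotents_lift_modulo :: "('a, 'm) ring_scheme \<Rightarrow> 'a set \<Rightarrow> bool" where
  "idempotents_lift_modulo R I \<longleftrightarrow> lifts_idempotents R (R Quot I) (\<lambda>a. I +>\<^bsub>R\<^esub> a)"


section \<open>Localization\<close>

text \<open>
  A multiplicative subset is a \<^locale>\<open>submonoid\<close> of the multiplicative monoid; it may contain
  \<open>0\<close>, in which case the localization is the zero ring. The relation does not presuppose that
  \<open>S\<close> consists of non-zero-divisors, hence the extra factor \<open>u\<close>.
\<close>

definition loc_rel ::
  "('a, 'm) ring_scheme \<Rightarrow> 'a set \<Rightarrow> (('a \<times> 'a) \<times> ('a \<times> 'a)) set" where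
  "loc_rel R S = {((a, s), (b, t)). a \<in> carrier R \<and> b \<in> carrier R \<and> s \<in> S \<and> t \<in> S \<and>
     (\<exists>u\<in>S. u \<otimes>\<^bsub>R\<^esub> (a \<otimes>\<^bsub>R\<^esub> t) = u \<otimes>\<^bsub>R\<^esub> (b \<otimes>\<^bsub>R\<^esub> s))}"

definition loc_frac :: "('a, 'm) ring_scheme \<Rightarrow> 'a set \<Rightarrow> 'a \<Rightarrow> 'a \<Rightarrow> ('a \<times> 'a) set" where
  "loc_frac R S a s = loc_rel R S `` {(a, s)}"

text \<open>
  The operations take the union over all representatives; since they are well defined, all the
  sets in such a union coincide (lemmas \<open>loc_mult_frac\<close> and \<open>loc_add_frac\<close>).
\<close>

definition localization :: "('a, 'm) ring_scheme \<Rightarrow> 'a set \<Rightarrow> ('a \<times> 'a) set ring" where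
  "localization R S =
    \<lparr>carrier = (carrier R \<times> S) // loc_rel R S,
     mult = (\<lambda>X Y. \<Union>(a, s)\<in>X. \<Union>(b, t)\<in>Y. loc_frac R S (a \<otimes>\<^bsub>R\<^esub> b) (s \<otimes>\<^bsub>R\<^esub> t)),
     one = loc_frac R S \<one>\<^bsub>R\<^esub> \<one>\<^bsub>R\<^esub>,
     zero = loc_frac R S \<zero>\<^bsub>R\<^esub> \<one>\<^bsub>R\<^esub>,
     add = (\<lambda>X Y. \<Union>(a, s)\<in>X. \<Union>(b, t)\<in>Y.
       loc_frac R S (a \<otimes>\<^bsub>R\<^esub> t \<oplus>\<^bsub>R\<^esub> b \<otimes>\<^bsub>R\<^esub> s) (s \<otimes>\<^bsub>R\<^esub> t))\<rparr>"

definition loc_map :: "('a, 'm) ring_scheme \<Rightarrow> 'a set \<Rightarrow> 'a \<Rightarrow> ('a \<times> 'a) set" where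
  "loc_map R S a = loc_frac R S a \<one>\<^bsub>R\<^esub>"

lemma localization_mult: "X \<otimes>\<^bsub>localization R S\<^esub> Y =
    (\<Union>(a, s)\<in>X. \<Union>(b, t)\<in>Y. loc_frac R S (a \<otimes>\<^bsub>R\<^esub> b) (s \<otimes>\<^bsub>R\<^esub> t))"
  by (simp add: localization_def)

lemma localization_add: "X \<oplus>\<^bsub>localization R S\<^esub> Y =
    (\<Union>(a, s)\<in>X. \<Union>(b, t)\<in>Y.
      loc_frac R S (a \<otimes>\<^bsub>R\<^esub> t \<oplus>\<^bsub>R\<^esub> b \<otimes>\<^bsub>R\<^esub> s) (s \<otimes>\<^bsub>R\<^esub> t))"
  by (simp add: localization_def)

lemma UN2_const:
  assumes "x \<in> A" "y \<in> B"
    and "\<And>a s b t. (a, s) \<in> A \<Longrightarrow> (b, t) \<in> B \<Longrightarrow> F a s b t = C"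
  shows "(\<Union>(a, s)\<in>A. \<Union>(b, t)\<in>B. F a s b t) = C"
  using assms by (intro SUP_eq_const; clarify?; (intro SUP_eq_const)?) auto

locale mult_subset = cring R + submonoid S R for R (structure) and S
begin

lemma S_carr [simp]: "s \<in> S \<Longrightarrow> s \<in> carrier R"
  using subset by blast

lemma loc_rel_equiv: "equiv (carrier R \<times> S) (loc_rel R S)"
proof (rule equivI)
  show "loc_rel R S \<subseteq> (carrier R \<times> S) \<times> (carrier R \<times> S)"
    by (auto simp: loc_rel_def)
  show "refl_on (carrier R \<times> S) (loc_rel R S)"
    by (auto simp: refl_on_def loc_rel_def)
  show "sym (loc_rel R S)"
    by (auto simp: sym_def loc_rel_def) metis
  show "trans (loc_rel R S)"
  proof (rule transI, clarify)
    fix a s b t c r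
    assume 1: "((a, s), (b, t)) \<in> loc_rel R S" and 2: "((b, t), (c, r)) \<in> loc_rel R S"
    then obtain u v where u: "u \<in> S" "u \<otimes> (a \<otimes> t) = u \<otimes> (b \<otimes> s)"
      and v: "v \<in> S" "v \<otimes> (b \<otimes> r) = v \<otimes> (c \<otimes> t)"
      unfolding loc_rel_def by blast
    have m: "a \<in> carrier R" "b \<in> carrier R" "c \<in> carrier R" "s \<in> S" "t \<in> S" "r \<in> S"
      using 1 2 by (auto simp: loc_rel_def)
    note c = m(1-3) m(4-6)[THEN S_carr] u(1)[THEN S_carr] v(1)[THEN S_carr]
    have "(u \<otimes> v \<otimes> t) \<otimes> (a \<otimes> r) = (u \<otimes> (a \<otimes> t)) \<otimes> (v \<otimes> r)"
      using c by (simp add: m_ac)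
    also have "\<dots> = (v \<otimes> (b \<otimes> r)) \<otimes> (u \<otimes> s)"
      unfolding u(2) using c by (simp add: m_ac)
    also have "\<dots> = (u \<otimes> v \<otimes> t) \<otimes> (c \<otimes> s)"
      unfolding v(2) using c by (simp add: m_ac)
    finally show "((a, s), (c, r)) \<in> loc_rel R S"
      using m u(1) v(1) unfolding loc_rel_def by blast
  qed
qed

lemma loc_frac_eq_iff:
  assumes "a \<in> carrier R" "b \<in> carrier R" "s \<in> S" "t \<in> S"
  shows "loc_frac R S a s = loc_frac R S b t \<longleftrightarrow> (\<exists>u\<in>S. u \<otimes> (a \<otimes> t) = u \<otimes> (b \<otimes> s))"
  unfolding loc_frac_def using assms eq_equiv_class_iff[OF loc_rel_equiv, of "(a, s)" "(b, t)"]
  by (simp add: loc_rel_def)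

lemma loc_fracI2:
  assumes "a \<in> carrier R" "b \<in> carrier R" "s \<in> S" "t \<in> S" "u \<in> S"
    and "u \<otimes> (a \<otimes> t) = u \<otimes> (b \<otimes> s)"
  shows "loc_frac R S a s = loc_frac R S b t"
  using assms loc_frac_eq_iff by blast

lemma loc_fracI:
  assumes "a \<in> carrier R" "b \<in> carrier R" "s \<in> S" "t \<in> S" "a \<otimes> t = b \<otimes> s"
  shows "loc_frac R S a s = loc_frac R S b t"
  using assms loc_frac_eq_iff one_closed by metis

lemma loc_frac_closed [simp]:
  "a \<in> carrier R \<Longrightarrow> s \<in> S \<Longrightarrow> loc_frac R S a s \<in> carrier (localization R S)"
  by (simp add: localization_def loc_frac_def quotientI)

lemma loc_carrE:
  assumes "X \<in> carrier (localization R S)"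
  obtains a s where "a \<in> carrier R" "s \<in> S" "X = loc_frac R S a s"
  using assms by (auto simp: localization_def loc_frac_def elim!: quotientE)

lemma loc_mult_frac:
  assumes "a \<in> carrier R" "b \<in> carrier R" "s \<in> S" "t \<in> S"
  shows "loc_frac R S a s \<otimes>\<^bsub>localization R S\<^esub> loc_frac R S b t
    = loc_frac R S (a \<otimes> b) (s \<otimes> t)"
proof -
  have *: "loc_frac R S (a' \<otimes> b') (s' \<otimes> t') = loc_frac R S (a \<otimes> b) (s \<otimes> t)"
    if 1: "((a, s), (a', s')) \<in> loc_rel R S" and 2: "((b, t), (b', t')) \<in> loc_rel R S"
    for a' s' b' t'
  proof -
    from 1 2 obtain u v where u: "u \<in> S" "u \<otimes> (a \<otimes> s') = u \<otimes> (a' \<otimes> s)"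
      and v: "v \<in> S" "v \<otimes> (b \<otimes> t') = v \<otimes> (b' \<otimes> t)"
      unfolding loc_rel_def by blast
    have m: "a' \<in> carrier R" "b' \<in> carrier R" "s' \<in> S" "t' \<in> S"
      using 1 2 by (auto simp: loc_rel_def)
    note c = assms m assms(3-4)[THEN S_carr] m(3-4)[THEN S_carr] u(1)[THEN S_carr] v(1)[THEN S_carr]
    have "(u \<otimes> v) \<otimes> ((a' \<otimes> b') \<otimes> (s \<otimes> t)) = (u \<otimes> (a' \<otimes> s)) \<otimes> (v \<otimes> (b' \<otimes> t))"
      using c by (simp add: m_ac)
    also have "\<dots> = (u \<otimes> v) \<otimes> ((a \<otimes> b) \<otimes> (s' \<otimes> t'))"
      unfolding u(2)[symmetric] v(2)[symmetric] using c by (simp add: m_ac)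
    finally show ?thesis
      by (rule loc_fracI2[rotated -1]) (use c u(1) v(1) in simp_all)
  qed
  have "(a, s) \<in> loc_frac R S a s" "(b, t) \<in> loc_frac R S b t"
    using assms equiv_class_self[OF loc_rel_equiv] by (auto simp: loc_frac_def)
  then show ?thesis
    unfolding localization_mult
  proof (rule UN2_const)
    fix a' s' b' t' assume "(a', s') \<in> loc_frac R S a s" "(b', t') \<in> loc_frac R S b t"
    then show "loc_frac R S (a' \<otimes> b') (s' \<otimes> t') = loc_frac R S (a \<otimes> b) (s \<otimes> t)"
      by (intro *) (simp_all only: loc_frac_def Image_singleton_iff)
  qed
qed

lemma loc_add_frac:
  assumes "a \<in> carrier R" "b \<in> carrier R" "s \<in> S" "t \<in> S"
  shows "loc_frac R S a s \<oplus>\<^bsub>localization R S\<^esub> loc_frac R S b t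
    = loc_frac R S (a \<otimes> t \<oplus> b \<otimes> s) (s \<otimes> t)"
proof -
  have *: "loc_frac R S (a' \<otimes> t' \<oplus> b' \<otimes> s') (s' \<otimes> t') = loc_frac R S (a \<otimes> t \<oplus> b \<otimes> s) (s \<otimes> t)"
    if 1: "((a, s), (a', s')) \<in> loc_rel R S" and 2: "((b, t), (b', t')) \<in> loc_rel R S"
    for a' s' b' t'
  proof -
    from 1 2 obtain u v where u: "u \<in> S" "u \<otimes> (a \<otimes> s') = u \<otimes> (a' \<otimes> s)"
      and v: "v \<in> S" "v \<otimes> (b \<otimes> t') = v \<otimes> (b' \<otimes> t)"
      unfolding loc_rel_def by blast
    have m: "a' \<in> carrier R" "b' \<in> carrier R" "s' \<in> S" "t' \<in> S"
      using 1 2 by (auto simp: loc_rel_def)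
    note c = assms m assms(3-4)[THEN S_carr] m(3-4)[THEN S_carr] u(1)[THEN S_carr] v(1)[THEN S_carr]
    have "(u \<otimes> v) \<otimes> ((a' \<otimes> t' \<oplus> b' \<otimes> s') \<otimes> (s \<otimes> t))
        = (u \<otimes> (a' \<otimes> s)) \<otimes> (v \<otimes> t \<otimes> t') \<oplus> (v \<otimes> (b' \<otimes> t)) \<otimes> (u \<otimes> s \<otimes> s')"
      using c by (simp add: m_ac l_distr r_distr)
    also have "\<dots> = (u \<otimes> v) \<otimes> ((a \<otimes> t \<oplus> b \<otimes> s) \<otimes> (s' \<otimes> t'))"
      unfolding u(2)[symmetric] v(2)[symmetric] using c by (simp add: m_ac l_distr r_distr)
    finally show ?thesis
      by (rule loc_fracI2[rotated -1]) (use c u(1) v(1) in simp_all)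
  qed
  have "(a, s) \<in> loc_frac R S a s" "(b, t) \<in> loc_frac R S b t"
    using assms equiv_class_self[OF loc_rel_equiv] by (auto simp: loc_frac_def)
  then show ?thesis
    unfolding localization_add
  proof (rule UN2_const)
    fix a' s' b' t' assume "(a', s') \<in> loc_frac R S a s" "(b', t') \<in> loc_frac R S b t"
    then show "loc_frac R S (a' \<otimes> t' \<oplus> b' \<otimes> s') (s' \<otimes> t') = loc_frac R S (a \<otimes> t \<oplus> b \<otimes> s) (s \<otimes> t)"
      by (intro *) (simp_all only: loc_frac_def Image_singleton_iff)
  qed
qed

lemma loc_one: "\<one>\<^bsub>localization R S\<^esub> = loc_frac R S \<one> \<one>"
  and loc_zero: "\<zero>\<^bsub>localization R S\<^esub> = loc_frac R S \<zero> \<one>"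
  by (simp_all add: localization_def)

lemmas loc_simps = loc_one loc_zero loc_mult_frac loc_add_frac

lemma localization_cring: "cring (localization R S)" (is "cring ?L")
proof (rule cringI)
  note ring_simps = m_ac a_ac l_distr r_distr
  show "abelian_group ?L"
  proof (rule abelian_groupI)
    fix X Y Z assume X: "X \<in> carrier ?L" and Y: "Y \<in> carrier ?L" and Z: "Z \<in> carrier ?L"
    from X obtain a s where a: "a \<in> carrier R" "s \<in> S" "X = loc_frac R S a s" by (rule loc_carrE)
    from Y obtain b t where b: "b \<in> carrier R" "t \<in> S" "Y = loc_frac R S b t" by (rule loc_carrE)
    from Z obtain c r where c: "c \<in> carrier R" "r \<in> S" "Z = loc_frac R S c r" by (rule loc_carrE)
    show "X \<oplus>\<^bsub>?L\<^esub> Y \<in> carrier ?L"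
      using a b by (simp add: loc_simps)
    show "X \<oplus>\<^bsub>?L\<^esub> Y \<oplus>\<^bsub>?L\<^esub> Z = X \<oplus>\<^bsub>?L\<^esub> (Y \<oplus>\<^bsub>?L\<^esub> Z)"
      using a b c by (simp add: loc_simps ring_simps)
    show "X \<oplus>\<^bsub>?L\<^esub> Y = Y \<oplus>\<^bsub>?L\<^esub> X"
      using a b by (simp add: loc_simps ring_simps)
    show "\<zero>\<^bsub>?L\<^esub> \<oplus>\<^bsub>?L\<^esub> X = X"
      using a by (simp add: loc_simps)
    have "loc_frac R S (\<ominus> a) s \<oplus>\<^bsub>?L\<^esub> X = loc_frac R S \<zero> (s \<otimes> s)"
      using a by (simp add: loc_simps l_minus l_neg)
    also have "\<dots> = \<zero>\<^bsub>?L\<^esub>"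
      unfolding loc_zero using a by (intro loc_fracI) simp_all
    finally show "\<exists>Y\<in>carrier ?L. Y \<oplus>\<^bsub>?L\<^esub> X = \<zero>\<^bsub>?L\<^esub>"
      using a by (intro bexI[of _ "loc_frac R S (\<ominus> a) s"]) simp_all
  qed (simp add: loc_zero)
  show "comm_monoid ?L"
  proof (rule comm_monoidI)
    fix X Y Z assume X: "X \<in> carrier ?L" and Y: "Y \<in> carrier ?L" and Z: "Z \<in> carrier ?L"
    from X obtain a s where a: "a \<in> carrier R" "s \<in> S" "X = loc_frac R S a s" by (rule loc_carrE)
    from Y obtain b t where b: "b \<in> carrier R" "t \<in> S" "Y = loc_frac R S b t" by (rule loc_carrE)
    from Z obtain c r where c: "c \<in> carrier R" "r \<in> S" "Z = loc_frac R S c r" by (rule loc_carrE)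
    show "X \<otimes>\<^bsub>?L\<^esub> Y \<in> carrier ?L"
      using a b by (simp add: loc_simps)
    show "X \<otimes>\<^bsub>?L\<^esub> Y \<otimes>\<^bsub>?L\<^esub> Z = X \<otimes>\<^bsub>?L\<^esub> (Y \<otimes>\<^bsub>?L\<^esub> Z)"
      using a b c by (simp add: loc_simps m_ac)
    show "X \<otimes>\<^bsub>?L\<^esub> Y = Y \<otimes>\<^bsub>?L\<^esub> X"
      using a b by (simp add: loc_simps m_ac)
    show "\<one>\<^bsub>?L\<^esub> \<otimes>\<^bsub>?L\<^esub> X = X"
      using a by (simp add: loc_simps)
  qed (simp add: loc_one)
  fix X Y Z assume X: "X \<in> carrier ?L" and Y: "Y \<in> carrier ?L" and Z: "Z \<in> carrier ?L"
  from X obtain a s where a: "a \<in> carrier R" "s \<in> S" "X = loc_frac R S a s" by (rule loc_carrE)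
  from Y obtain b t where b: "b \<in> carrier R" "t \<in> S" "Y = loc_frac R S b t" by (rule loc_carrE)
  from Z obtain c r where c: "c \<in> carrier R" "r \<in> S" "Z = loc_frac R S c r" by (rule loc_carrE)
  have "loc_frac R S ((a \<otimes> t \<oplus> b \<otimes> s) \<otimes> c) (s \<otimes> t \<otimes> r)
      = loc_frac R S (a \<otimes> c \<otimes> (t \<otimes> r) \<oplus> b \<otimes> c \<otimes> (s \<otimes> r)) (s \<otimes> r \<otimes> (t \<otimes> r))"
    using a b c by (intro loc_fracI) (simp_all add: ring_simps)
  then show "(X \<oplus>\<^bsub>?L\<^esub> Y) \<otimes>\<^bsub>?L\<^esub> Z = X \<otimes>\<^bsub>?L\<^esub> Z \<oplus>\<^bsub>?L\<^esub> Y \<otimes>\<^bsub>?L\<^esub> Z"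
    using a b c by (simp add: loc_simps)
qed

lemma loc_map_ring_hom: "loc_map R S \<in> ring_hom R (localization R S)"
  by (rule ring_hom_memI) (simp_all add: loc_map_def loc_simps)

lemma loc_map_Units:
  assumes "s \<in> S"
  shows "loc_map R S s \<in> Units (localization R S)"
proof -
  have "loc_frac R S s s = loc_frac R S \<one> \<one>"
    using assms by (intro loc_fracI) simp_all
  then show ?thesis
    unfolding Units_def using assms
    by (simp add: loc_map_def loc_simps) (rule bexI[of _ "loc_frac R S \<one> s"]; simp add: loc_simps)
qed

end

end

theory Submission
  imports Defs "HOL-Algebra.Ring_Divisibility"
begin

text \<open>
  In a zero dimensional ring every chain of powers \<open>a\<^sup>n R\<close> stabilizes: the elements
  \<open>a\<^sup>n (1 - a b)\<close> form a multiplicative set, and a prime ideal avoiding it would be a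
  maximal ideal that contains neither \<open>a\<close> nor any \<open>1 - a b\<close>, which is absurd; so
  \<open>a\<^sup>n = a\<^sup>n a b\<close> for some \<open>n\<close> and \<open>b\<close>. Then \<open>(a b)\<^sup>n\<close> is idempotent, and it has the same
  image as \<open>a\<close> under every homomorphism that sends \<open>a\<close> to an idempotent. Hence idempotents
  lift along every surjective homomorphism. Localizations are surjective as well:
  \<open>s\<^sup>n = s\<^sup>n s t\<close> gives \<open>a/s = a t/1\<close>.
\<close>

text \<open>Zorn's lemma on the ideals that omit \<open>\<one>\<close>: the union of a nonempty
  chain of them omits \<open>\<one>\<close> too. It will be applied to a localization, whose maximal
  ideals pull back to primes of the base ring.\<close>

lemma (in cring) exists_maximalideal:
  assumes "\<one> \<noteq> \<zero>"
  shows "\<exists>J. maximalideal J R"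
proof -
  define A where "A = {I. ideal I R \<and> \<one> \<notin> I}"
  have "\<exists>M\<in>A. \<forall>X\<in>A. M \<subseteq> X \<longrightarrow> X = M"
  proof (rule subset_Zorn_nonempty)
    show "A \<noteq> {}"
      using assms zeroideal unfolding A_def by blast
    show "\<Union>C \<in> A" if "C \<noteq> {}" "subset.chain A C" for C
    proof -
      have "subset.chain {I. ideal I R} C"
        using that(2) unfolding A_def pred_on.chain_def by blast
      then have "ideal (\<Union>C) R"
        using chain_Union_is_ideal[of C] that(1) by simp
      then show ?thesis
        using that(2) unfolding A_def pred_on.chain_def by blast
    qed
  qed
  then obtain M where M: "ideal M R" "\<one> \<notin> M"
      "\<And>X. ideal X R \<Longrightarrow> \<one> \<notin> X \<Longrightarrow> M \<subseteq> X \<Longrightarrow> X = M"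
    unfolding A_def by blast
  have "maximalideal M R"
    by (rule maximalidealI) (use M ideal.one_imp_carrier in \<open>blast+\<close>)
  then show ?thesis ..
qed

text \<open>The localization is nonzero, so it has a maximal ideal, and the preimage of that ideal
  under \<open>loc_map\<close> is prime. The preimage misses \<open>S\<close> because elements of
  \<open>S\<close> become units.\<close>

lemma (in mult_subset) exists_primeideal_avoiding:
  assumes "\<zero> \<notin> S"
  shows "\<exists>P. primeideal P R \<and> P \<inter> S = {}"
proof -
  let ?L = "localization R S"
  interpret L: cring ?L by (rule localization_cring)
  \<comment> \<open>Equality of the two fractions would give some \<open>u\<close> in
    \<open>S\<close> with \<open>u = \<zero>\<close>.\<close>
  have "\<one>\<^bsub>?L\<^esub> \<noteq> \<zero>\<^bsub>?L\<^esub>"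
    using assms by (auto simp: loc_one loc_zero loc_frac_eq_iff)
  then obtain J where J: "maximalideal J ?L"
    using L.exists_maximalideal by blast
  then interpret J: maximalideal J ?L .
  interpret hom: ring_hom_ring R ?L "loc_map R S"
    by (rule ring_hom_ringI2[OF ring_axioms L.ring_axioms loc_map_ring_hom])
  let ?P = "{r \<in> carrier R. loc_map R S r \<in> J}"
  have "loc_map R S s \<notin> J" if "s \<in> S" for s
  proof
    assume "loc_map R S s \<in> J"
    then have "\<one>\<^bsub>?L\<^esub> \<in> J"
      using loc_map_Units[OF that] J.I_l_closed unfolding Units_def by force
    then show False
      using J.one_imp_carrier J.I_notcarr by blast
  qed
  moreover have "primeideal ?P R"
    using hom.primeideal_vimage[OF is_cring L.maximalideal_prime[OF J]] .
  ultimately show ?thesis by blast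
qed

text \<open>By maximality \<open>P\<close> and \<open>a\<close> together generate the whole ring, so
  \<open>\<one> = p \<oplus> b \<otimes> a\<close> with \<open>p\<close> in \<open>P\<close>:
  \<open>a\<close> is invertible modulo \<open>P\<close>.\<close>

lemma (in cring) maximalideal_inverse:
  assumes "maximalideal P R" "a \<in> carrier R" "a \<notin> P"
  shows "\<exists>b\<in>carrier R. \<one> \<ominus> a \<otimes> b \<in> P"
proof -
  interpret maximalideal P R by fact
  let ?J = "P <+>\<^bsub>R\<^esub> PIdl a"
  have I: "ideal ?J R"
    by (rule add_ideals[OF is_ideal cgenideal_ideal[OF assms(2)]])
  have mem: "p \<oplus> c \<in> ?J" if "p \<in> P" "c \<in> PIdl a" for p c
    using that unfolding set_add_def' by blast
  have zero: "\<zero> \<in> PIdl a"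
    by (intro additive_subgroup.zero_closed ideal.axioms(1) cgenideal_ideal assms(2))
  have "P \<subseteq> ?J"
  proof
    fix p assume "p \<in> P"
    then show "p \<in> ?J"
      using mem[OF _ zero] Icarr by fastforce
  qed
  moreover have "a \<in> ?J"
    using mem[OF zero_closed cgenideal_self[OF assms(2)]] assms(2) by simp
  ultimately have "?J = carrier R"
    using I_maximal[OF I] ideal.Icarr[OF I] assms(3) by blast
  then have "\<one> \<in> ?J" by simp
  then obtain p b where pb: "p \<in> P" "b \<in> carrier R" "\<one> = p \<oplus> b \<otimes> a"
    unfolding set_add_def' cgenideal_def by blast
  then have "\<one> \<ominus> a \<otimes> b = p"
    using Icarr assms(2) by (simp add: minus_eq a_assoc r_neg m_comm)
  with pb show ?thesis by blast
qed

lemma (in cring) zero_dimensional_power_stable: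
  assumes "zero_dimensional R" "a \<in> carrier R"
  shows "\<exists>n::nat. \<exists>b\<in>carrier R. a [^] n = a [^] n \<otimes> (a \<otimes> b)"
proof -
  define M where "M = {a [^] n \<otimes> (\<one> \<ominus> a \<otimes> b) | (n::nat) b. b \<in> carrier R}"
  have pow: "a [^] n \<otimes> (\<one> \<ominus> a \<otimes> b) \<in> M" if "b \<in> carrier R" for n :: nat and b
    using that unfolding M_def by blast
  interpret M: mult_subset R M
  proof (intro mult_subset.intro submonoid.intro is_cring)
    show "M \<subseteq> carrier R"
      using assms(2) unfolding M_def by auto
    show "\<one> \<in> M"
      using pow[of \<zero> 0] assms(2) by (simp add: minus_eq)
    show "x \<otimes> y \<in> M" if xy: "x \<in> M" "y \<in> M" for x y
    proof -
      from xy obtain m n :: nat and b c where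
        b: "b \<in> carrier R" "x = a [^] m \<otimes> (\<one> \<ominus> a \<otimes> b)" and
        c: "c \<in> carrier R" "y = a [^] n \<otimes> (\<one> \<ominus> a \<otimes> c)"
        unfolding M_def by blast
      \<comment> \<open>The product of two such factors is again one minus a multiple of
        \<open>a\<close>, while the exponents of \<open>a\<close> add up.\<close>
      have "(\<one> \<ominus> a \<otimes> b) \<otimes> (\<one> \<ominus> a \<otimes> c) = \<one> \<ominus> a \<otimes> (b \<oplus> c \<ominus> a \<otimes> b \<otimes> c)"
        using assms(2) b(1) c(1) by algebra
      then have "x \<otimes> y = a [^] (m + n) \<otimes> (\<one> \<ominus> a \<otimes> (b \<oplus> c \<ominus> a \<otimes> b \<otimes> c))"
        using assms(2) b c by (simp add: nat_pow_mult[symmetric] m_ac)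
      then show ?thesis
        using pow[of "b \<oplus> c \<ominus> a \<otimes> b \<otimes> c"] assms(2) b(1) c(1) by simp
    qed
  qed
  have "\<zero> \<in> M"
  proof (rule ccontr)
    assume "\<zero> \<notin> M"
    then obtain P where P: "primeideal P R" "P \<inter> M = {}"
      using M.exists_primeideal_avoiding by blast
    interpret maximalideal P R
      using assms(1) P(1) unfolding zero_dimensional_def by blast
    \<comment> \<open>\<open>P\<close> avoids \<open>M\<close>, which contains \<open>a\<close>
      (exponent 1, \<open>b\<close> zero) and every \<open>\<one> \<ominus> a \<otimes> b\<close>
      (exponent 0).\<close>
    have "a \<notin> P"
    proof
      assume "a \<in> P"
      moreover have "a \<in> M"
        using pow[of \<zero> 1] assms(2) by (simp add: minus_eq)
      ultimately show False using P(2) by blast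
    qed
    then obtain b where "b \<in> carrier R" "\<one> \<ominus> a \<otimes> b \<in> P"
      using maximalideal_inverse[OF is_maximalideal assms(2)] by blast
    then show False
      using pow[of b 0] P(2) assms(2) by auto
  qed
  then obtain n :: nat and b where b: "b \<in> carrier R" "\<zero> = a [^] n \<otimes> (\<one> \<ominus> a \<otimes> b)"
    unfolding M_def by blast
  then have "a [^] n \<ominus> a [^] n \<otimes> (a \<otimes> b) = \<zero>"
    using assms(2) by (simp add: minus_eq r_distr r_minus)
  then show ?thesis
    using b(1) assms(2) r_right_minus_eq by auto
qed

lemma zero_dimensional_lifts_idempotents:
  assumes "ring_hom_cring R T h" "zero_dimensional R" "h ` carrier R = carrier T"
  shows "lifts_idempotents R T h"
  unfolding lifts_idempotents_def
proof
  interpret ring_hom_cring R T h by fact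
  fix f assume "f \<in> ring_idempotents T"
  then have f: "f \<in> carrier T" "f \<otimes>\<^bsub>T\<^esub> f = f"
    unfolding ring_idempotents_def by auto
  from f(1) have "f \<in> h ` carrier R"
    using assms(3) by simp
  then obtain x where x: "x \<in> carrier R" "h x = f"
    by (elim imageE) simp
  obtain n :: nat and b where b: "b \<in> carrier R" "x [^]\<^bsub>R\<^esub> n = x [^]\<^bsub>R\<^esub> n \<otimes>\<^bsub>R\<^esub> (x \<otimes>\<^bsub>R\<^esub> b)"
    using R.zero_dimensional_power_stable[OF assms(2) x(1)] by (elim exE bexE)
  define y where "y = x \<otimes>\<^bsub>R\<^esub> b"
  have y: "y \<in> carrier R"
    using x b unfolding y_def by simp
  \<comment> \<open>Since \<open>x [^] n\<close> absorbs \<open>y\<close>, so does its multiple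
    \<open>y [^] n\<close>.\<close>
  have pow_y: "y [^]\<^bsub>R\<^esub> n \<otimes>\<^bsub>R\<^esub> y = y [^]\<^bsub>R\<^esub> n"
  proof -
    have yn: "y [^]\<^bsub>R\<^esub> n = b [^]\<^bsub>R\<^esub> n \<otimes>\<^bsub>R\<^esub> x [^]\<^bsub>R\<^esub> n"
      using x b(1) by (simp add: y_def R.nat_pow_distrib R.m_comm)
    then have "y [^]\<^bsub>R\<^esub> n \<otimes>\<^bsub>R\<^esub> y = b [^]\<^bsub>R\<^esub> n \<otimes>\<^bsub>R\<^esub> (x [^]\<^bsub>R\<^esub> n \<otimes>\<^bsub>R\<^esub> y)"
      using x(1) b(1) y by (simp add: R.m_assoc)
    also have "x [^]\<^bsub>R\<^esub> n \<otimes>\<^bsub>R\<^esub> y = x [^]\<^bsub>R\<^esub> n"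
      unfolding y_def by (rule b(2)[symmetric])
    finally show ?thesis
      unfolding yn .
  qed
  \<comment> \<open>At \<open>k = n\<close> this is the idempotence of \<open>y [^] n\<close>, the
    lift sought.\<close>
  have absorb: "y [^]\<^bsub>R\<^esub> n \<otimes>\<^bsub>R\<^esub> y [^]\<^bsub>R\<^esub> k = y [^]\<^bsub>R\<^esub> n" for k :: nat
    by (induction k) (use y pow_y in \<open>simp_all flip: R.m_assoc\<close>)
  have fpow: "f [^]\<^bsub>T\<^esub> k \<otimes>\<^bsub>T\<^esub> f = f" for k :: nat
    by (induction k) (use f in \<open>simp_all add: S.m_assoc\<close>)
  have hpow: "h (x [^]\<^bsub>R\<^esub> n) = f [^]\<^bsub>T\<^esub> n"
    using x hom_nat_pow by simp
  \<comment> \<open>Apply \<open>h\<close> to the stability relation and multiply by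
    \<open>f\<close>: by \<open>fpow\<close> the powers of \<open>f\<close> collapse, leaving
    \<open>f = f \<otimes> h b\<close>, which is \<open>h y\<close>.\<close>
  have hy: "h y = f"
  proof -
    have "f [^]\<^bsub>T\<^esub> n = f [^]\<^bsub>T\<^esub> n \<otimes>\<^bsub>T\<^esub> (f \<otimes>\<^bsub>T\<^esub> h b)"
      using arg_cong[OF b(2), of h] x b(1) hpow by simp
    then have "f [^]\<^bsub>T\<^esub> n \<otimes>\<^bsub>T\<^esub> f = f [^]\<^bsub>T\<^esub> n \<otimes>\<^bsub>T\<^esub> (f \<otimes>\<^bsub>T\<^esub> h b) \<otimes>\<^bsub>T\<^esub> f"
      by simp
    also have "\<dots> = (f [^]\<^bsub>T\<^esub> n \<otimes>\<^bsub>T\<^esub> f) \<otimes>\<^bsub>T\<^esub> f \<otimes>\<^bsub>T\<^esub> h b"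
      using f(1) b(1) by (simp add: S.m_ac)
    finally show ?thesis
      using f x b(1) by (simp add: fpow y_def)
  qed
  \<comment> \<open>The exponent \<open>Suc n\<close> also covers \<open>n = 0\<close>, where
    \<open>f [^] n\<close> is one; \<open>pow_y\<close> then removes the additional factor
    \<open>y\<close>.\<close>
  have "h (y [^]\<^bsub>R\<^esub> Suc n) = f"
    using y f(1) hy fpow hom_nat_pow by simp
  then have "h (y [^]\<^bsub>R\<^esub> n) = f"
    using pow_y by simp
  moreover have "y [^]\<^bsub>R\<^esub> n \<in> ring_idempotents R"
    using absorb y unfolding ring_idempotents_def by simp
  ultimately show "\<exists>e\<in>ring_idempotents R. h e = f" by blast
qed

lemma (in mult_subset) zero_dimensional_loc_map_surj:
  assumes "zero_dimensional R"
  shows "loc_map R S ` carrier R = carrier (localization R S)"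
proof
  show "loc_map R S ` carrier R \<subseteq> carrier (localization R S)"
    by (auto simp: loc_map_def)
  show "carrier (localization R S) \<subseteq> loc_map R S ` carrier R"
  proof
    fix X assume "X \<in> carrier (localization R S)"
    then obtain a s where a: "a \<in> carrier R" "s \<in> S" "X = loc_frac R S a s"
      by (rule loc_carrE)
    obtain n :: nat and t where t: "t \<in> carrier R" "s [^] n = s [^] n \<otimes> (s \<otimes> t)"
      using zero_dimensional_power_stable[OF assms] a(2) S_carr by blast
    \<comment> \<open>This power is the multiplier \<open>u\<close> that \<open>loc_rel\<close>
      allows: \<open>s \<otimes> t\<close> need not be \<open>\<one>\<close> in \<open>R\<close>,
      but it acts as \<open>\<one>\<close> on \<open>s [^] n\<close>.\<close>
    have pow: "s [^] n \<in> S"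
      by (induction n) (use a(2) in simp_all)
    have "s [^] n \<otimes> (a \<otimes> \<one>) = s [^] n \<otimes> (s \<otimes> t) \<otimes> a"
      using a t by simp
    also have "\<dots> = s [^] n \<otimes> (a \<otimes> t \<otimes> s)"
      using a(1) S_carr[OF a(2)] t(1) by (simp add: m_ac)
    finally have "X = loc_map R S (a \<otimes> t)"
      unfolding a(3) loc_map_def using a t(1) pow by (intro loc_fracI2) simp_all
    then show "X \<in> loc_map R S ` carrier R"
      using a(1) t(1) by blast
  qed
qed

theorem corollary3p23:
  fixes R :: "('a, 'm) ring_scheme" (structure)
  assumes "cring R"
    and "zero_dimensional R"
  shows "(\<forall>I. ideal I R \<longrightarrow> idempotents_lift_modulo R I) \<and>
    (reduced_ring R \<longrightarrow>
      (\<forall>S. submonoid S R \<longrightarrow> lifts_idempotents R (localization R S) (loc_map R S)))"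
proof (intro conjI allI impI)
  fix I assume "ideal I R"
  then interpret ideal I R .
  have "(\<lambda>a. I +>\<^bsub>R\<^esub> a) ` carrier R = carrier (R Quot I)"
    by (auto simp: FactRing_simps)
  then show "idempotents_lift_modulo R I"
    unfolding idempotents_lift_modulo_def
    by (intro zero_dimensional_lifts_idempotents rcos_ring_hom_cring assms)
next
  fix S assume "submonoid S R"
  then interpret mult_subset R S
    using assms(1) by (intro mult_subset.intro)
  have "ring_hom_cring R (localization R S) (loc_map R S)"
    by (rule ring_hom_cringI[OF is_cring localization_cring loc_map_ring_hom])
  then show "lifts_idempotents R (localization R S) (loc_map R S)"
    using assms(2) zero_dimensional_loc_map_surj
    by (intro zero_dimensional_lifts_idempotents)
qed

end
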